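(* Let $\varepsilon\in\mathbb{C}$ and consider the system $$\frac{dx}{dt}=y-\frac{\varepsilon}{3}x,\qquad \frac{dy}{dt}=-xz+x-\varepsilon y,\qquad \frac{dz}{dt}=xy.$$ The phase space $\mathcal{X}$ for this system is obtained by gluing three copies of $\mathbb{C}^3$, $U_j\cong\mathbb{C}^3\ni(x_j,y_j,z_j)$, $j=0,1,2$, via the following birational transformations: 0) $x_0=x,\quad y_0=y,\quad z_0=z$; 1) $x_1=\dfrac{1}{x}$, $\quad y_1=-\left(\left(y-\frac{\varepsilon}{3}x-\sqrt{-1}\,z+\frac{\sqrt{-1}(5\varepsilon^2+9)}{9}\right)x+\frac{4\varepsilon}{9}(3z+\varepsilon^2-3)\right)x$, $\quad z_1=z-\frac{1}{6}(3x-4\sqrt{-1}\,\varepsilon)x$; 2) $x_2=\dfrac{1}{x}$, $\quad y_2=-\left(\left(y-\frac{\varepsilon}{3}x+\sqrt{-1}\,z-\frac{\sqrt{-1}(5\varepsilon^2+9)}{9}\right)x+\frac{4\varepsilon}{9}(3z+\varepsilon^2-3)\right)x$, $\quad z_2=z-\frac{1}{6}(3x+4\sqrt{-1}\,\varepsilon)x$. Moreover, these transition functions satisfy $$dx_i\wedge dy_i\wedge dz_i=dx\wedge dy\wedge dz\qquad(i=1,2).$$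
   Context: Phase space: put $(X,Y,Z)=(1/x,\;y/x^2,\;z/x^2)$. In this coordinate system the system has, on the boundary divisor $\{X=0\}$, the accessible singular points $P_4=\left(0,\frac{\sqrt{-1}}{2},\frac12\right)$ and $P_5=\left(0,-\frac{\sqrt{-1}}{2},\frac12\right)$ (points of the divisor where the vector field has the form $a_1\partial_{x_1}+\frac{a_2}{x_1}\partial_{x_2}+\frac{a_3}{x_1}\partial_{x_3}$ with $x_1=0$ defining the divisor, $a_i$ holomorphic, and $a_2=a_3=0$ at the point). The phase space for the system is the complex manifold obtained by gluing to the original $\mathbb{C}^3$ the final affine charts (each isomorphic to $\mathbb{C}^3$, coordinates taken up to sign) of the resolutions of $P_4$ and $P_5$ by successive blow-ups; in each of the charts of the phase space the system must again have polynomial right-hand side, i.e. the vector field is regular on the whole phase space. Explicitly, with $s=1$ for $P_4$ and $s=-1$ for $P_5$, the resolution is as follows. Set $p=X$, $q^{(1)}=\left(Y-\frac{s\sqrt{-1}}{2}\right)-s\sqrt{-1}\left(Z-\frac12\right)$, $r^{(1)}=Z-\frac12$. Blow up the point $(p,q^{(1)},r^{(1)})=(0,0,0)$: $q^{(2)}=q^{(1)}/p$, $r^{(2)}=r^{(1)}/p$. Blow up the point $(p,q^{(2)},r^{(2)})=\left(0,-\frac{\varepsilon}{3},-\frac{2s\sqrt{-1}\,\varepsilon}{3}\right)$: $q^{(3)}=\left(q^{(2)}+\frac{\varepsilon}{3}\right)/p$, $r^{(3)}=\left(r^{(2)}+\frac{2s\sqrt{-1}\,\varepsilon}{3}\right)/p$.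 Blow up the curve $p=0$, $q^{(3)}=\frac{s\sqrt{-1}}{3}(\varepsilon^2-3)$: $q^{(4)}=\left(q^{(3)}-\frac{s\sqrt{-1}}{3}(\varepsilon^2-3)\right)/p$, $r^{(4)}=r^{(3)}$. Blow up the curve $p=0$, $q^{(4)}=-\frac{4\varepsilon}{3}r^{(4)}-\frac{4\varepsilon}{9}(\varepsilon^2-3)$: the final chart has coordinates $u=p$, $v=\left(q^{(4)}+\frac{4\varepsilon}{3}r^{(4)}+\frac{4\varepsilon}{9}(\varepsilon^2-3)\right)/p$, $w=r^{(4)}$. *)

theory Defs
  imports "HOL-Analysis.Analysis"
begin

type_synonym c3 = "complex ^ 3"

section \<open>Functions of three complex variables\<close>

text \<open>Holomorphy is real differentiability with complex-linear derivative; \<open>*v\<close> is the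
  product with a complex matrix.\<close>

definition holomorphic3 :: "(c3 \<Rightarrow> c3) \<Rightarrow> c3 set \<Rightarrow> bool" where
  "holomorphic3 f S \<longleftrightarrow> open S \<and>
     (\<forall>p\<in>S. \<exists>A :: complex ^ 3 ^ 3. (f has_derivative (\<lambda>h. A *v h)) (at p))"

definition polynomial3 :: "(c3 \<Rightarrow> complex) \<Rightarrow> bool" where
  "polynomial3 f \<longleftrightarrow> (\<exists>(N::nat) (c :: nat \<Rightarrow> nat \<Rightarrow> nat \<Rightarrow> complex). \<forall>p.
     f p = (\<Sum>i\<le>N. \<Sum>j\<le>N. \<Sum>k\<le>N. c i j k * (p $ 1) ^ i * (p $ 2) ^ j * (p $ 3) ^ k))"

definition rational_on3 :: "c3 set \<Rightarrow> (c3 \<Rightarrow> c3) \<Rightarrow> bool" where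
  "rational_on3 S f \<longleftrightarrow> (\<forall>k. \<exists>g h. polynomial3 g \<and> polynomial3 h \<and>
     (\<forall>p\<in>S. h p \<noteq> 0 \<and> f p $ k = g p / h p))"

definition principal_open3 :: "c3 set \<Rightarrow> bool" where
  "principal_open3 S \<longleftrightarrow> S \<noteq> {} \<and> (\<exists>h. polynomial3 h \<and> S = {p. h p \<noteq> 0})"

text \<open>A birational self-map of affine 3-space, together with nonempty Zariski open sets
  between which it is an isomorphism.\<close>

definition birational_between :: "c3 set \<Rightarrow> c3 set \<Rightarrow> (c3 \<Rightarrow> c3) \<Rightarrow> bool" where
  "birational_between S T f \<longleftrightarrow> principal_open3 S \<and> principal_open3 T \<and> bij_betw f S T \<and>
     rational_on3 S f \<and> rational_on3 T (inv_into S f)"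

section \<open>Differential forms and vector fields\<close>

definition diff_form :: "(c3 \<Rightarrow> complex) \<Rightarrow> c3 \<Rightarrow> c3 \<Rightarrow> complex" where
  "diff_form f p = frechet_derivative f (at p)"

definition wedge3 ::
  "(c3 \<Rightarrow> complex) \<Rightarrow> (c3 \<Rightarrow> complex) \<Rightarrow> (c3 \<Rightarrow> complex) \<Rightarrow> c3 \<Rightarrow> c3 \<Rightarrow> c3 \<Rightarrow> complex" where
  "wedge3 \<alpha> \<beta> \<gamma> = (\<lambda>h\<^sub>1 h\<^sub>2 h\<^sub>3.
     det (vector [vector [\<alpha> h\<^sub>1, \<alpha> h\<^sub>2, \<alpha> h\<^sub>3],
                  vector [\<beta> h\<^sub>1, \<beta> h\<^sub>2, \<beta> h\<^sub>3],
                  vector [\<gamma> h\<^sub>1, \<gamma> h\<^sub>2, \<gamma> h\<^sub>3]] :: complex ^ 3 ^ 3))"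

text \<open>The vector field \<open>V\<close> in the coordinates \<open>\<phi>\<close>, as a function of the original point.\<close>

definition transport :: "(c3 \<Rightarrow> c3) \<Rightarrow> (c3 \<Rightarrow> c3) \<Rightarrow> c3 \<Rightarrow> c3" where
  "transport \<phi> V p = frechet_derivative \<phi> (at p) (V p)"

definition polynomial_in_chart :: "(c3 \<Rightarrow> c3) \<Rightarrow> c3 set \<Rightarrow> (c3 \<Rightarrow> c3) \<Rightarrow> bool" where
  "polynomial_in_chart V S \<phi> \<longleftrightarrow>
     (\<exists>W. (\<forall>k. polynomial3 (\<lambda>a. W a $ k)) \<and> (\<forall>p\<in>S. transport \<phi> V p = W (\<phi> p)))"

definition system_field :: "complex \<Rightarrow> c3 \<Rightarrow> c3" where
  "system_field \<epsilon> p = (let x = p $ 1; y = p $ 2; z = p $ 3 in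
     vector [y - \<epsilon> / 3 * x, - x * z + x - \<epsilon> * y, x * y])"

section \<open>Gluing copies of affine space\<close>

text \<open>\<open>\<phi> j\<close> gives the coordinates on the \<open>j\<close>-th copy in terms of those of a common reference
  space and is meaningful on \<open>D j\<close>; copies \<open>i\<close> and \<open>j\<close> are glued along
  \<open>\<phi> j \<circ> (\<phi> i)\<inverse>\<close>.\<close>

definition glue_rel ::
  "'i set \<Rightarrow> ('i \<Rightarrow> c3 set) \<Rightarrow> ('i \<Rightarrow> c3 \<Rightarrow> c3) \<Rightarrow> (('i \<times> c3) \<times> ('i \<times> c3)) set" where
  "glue_rel I D \<phi> = {((i, a), (j, b)). i \<in> I \<and> j \<in> I \<and>
     ((i = j \<and> a = b) \<or> (\<exists>p \<in> D i \<inter> D j. \<phi> i p = a \<and> \<phi> j p = b))}"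

definition glue_inj ::
  "'i set \<Rightarrow> ('i \<Rightarrow> c3 set) \<Rightarrow> ('i \<Rightarrow> c3 \<Rightarrow> c3) \<Rightarrow> 'i \<Rightarrow> c3 \<Rightarrow> ('i \<times> c3) set" where
  "glue_inj I D \<phi> j a = glue_rel I D \<phi> `` {(j, a)}"

text \<open>Quotient topology of the disjoint union.\<close>

definition glue_space ::
  "'i set \<Rightarrow> ('i \<Rightarrow> c3 set) \<Rightarrow> ('i \<Rightarrow> c3 \<Rightarrow> c3) \<Rightarrow> ('i \<times> c3) set topology" where
  "glue_space I D \<phi> = topology (\<lambda>W. W \<subseteq> (I \<times> UNIV) // glue_rel I D \<phi> \<and>
     openin (sum_topology (\<lambda>_. euclidean) I) {x \<in> I \<times> UNIV. glue_rel I D \<phi> `` {x} \<in> W})"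

lemma openin_glue_space:
  "openin (glue_space I D \<phi>) W \<longleftrightarrow> W \<subseteq> (I \<times> UNIV) // glue_rel I D \<phi> \<and>
     openin (sum_topology (\<lambda>_. euclidean) I) {x \<in> I \<times> UNIV. glue_rel I D \<phi> `` {x} \<in> W}"
proof -
  let ?R = "glue_rel I D \<phi>"
  let ?f = "\<lambda>W. {x \<in> I \<times> UNIV. ?R `` {x} \<in> W}"
  let ?P = "\<lambda>W. W \<subseteq> (I \<times> UNIV) // ?R \<and> openin (sum_topology (\<lambda>_. euclidean) I) (?f W)"
  have inter: "?f (S \<inter> T) = ?f S \<inter> ?f T" for S T by auto
  have union: "?f (\<Union>K) = (\<Union>S\<in>K. ?f S)" for K by auto
  have "istopology ?P"
    unfolding istopology_def
  proof (intro conjI allI impI)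
    fix S T assume "?P S" "?P T"
    then show "S \<inter> T \<subseteq> (I \<times> UNIV) // ?R"
      and "openin (sum_topology (\<lambda>_. euclidean) I) (?f (S \<inter> T))"
      unfolding inter by auto
  next
    fix K assume "\<forall>S\<in>K. ?P S"
    then show "\<Union>K \<subseteq> (I \<times> UNIV) // ?R"
      and "openin (sum_topology (\<lambda>_. euclidean) I) (?f (\<Union>K))"
      unfolding union by auto
  qed
  then show ?thesis by (simp add: glue_space_def)
qed

text \<open>\<open>\<iota> j\<close> is the inverse of a chart whose image is all of affine 3-space.\<close>

definition complex_threefold :: "'x topology \<Rightarrow> 'i set \<Rightarrow> ('i \<Rightarrow> c3 \<Rightarrow> 'x) \<Rightarrow> bool" where
  "complex_threefold X I \<iota> \<longleftrightarrow>
     Hausdorff_space X \<and> second_countable X \<and>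
     topspace X = (\<Union>j\<in>I. range (\<iota> j)) \<and>
     (\<forall>j\<in>I. embedding_map euclidean X (\<iota> j) \<and> openin X (range (\<iota> j))) \<and>
     (\<forall>i\<in>I. \<forall>j\<in>I. holomorphic3 (\<lambda>a. inv (\<iota> j) (\<iota> i a)) {a. \<iota> i a \<in> range (\<iota> j)})"

section \<open>Accessible singular points and their resolution\<close>

definition boundary_chart :: "c3 \<Rightarrow> c3" where
  "boundary_chart p = (let x = p $ 1; y = p $ 2; z = p $ 3 in
     vector [1 / x, y / x ^ 2, z / x ^ 2])"

text \<open>\<open>P\<close> is given in the coordinates of \<open>boundary_chart\<close>; the boundary divisor is the
  vanishing locus of the first coordinate.\<close>

definition accessible_singular_point :: "(c3 \<Rightarrow> c3) \<Rightarrow> c3 \<Rightarrow> bool" where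
  "accessible_singular_point V P \<longleftrightarrow> P $ 1 = 0 \<and>
     (\<exists>N a. P \<in> N \<and> holomorphic3 a N \<and> a P $ 2 = 0 \<and> a P $ 3 = 0 \<and>
       (\<forall>p. p $ 1 \<noteq> 0 \<longrightarrow> boundary_chart p \<in> N \<longrightarrow>
          transport boundary_chart V p =
            (let Q = boundary_chart p in
               vector [a Q $ 1, a Q $ 2 / Q $ 1, a Q $ 3 / Q $ 1])))"

text \<open>The parameter \<open>s\<close> is \<open>1\<close> for the point \<open>P\<^sub>4\<close> and \<open>-1\<close> for \<open>P\<^sub>5\<close>.\<close>

definition sing_point :: "complex \<Rightarrow> c3" where
  "sing_point s = vector [0, s * \<i> / 2, 1 / 2]"

definition local_coords :: "complex \<Rightarrow> c3 \<Rightarrow> c3" where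
  "local_coords s Q =
     vector [Q $ 1, (Q $ 2 - s * \<i> / 2) - s * \<i> * (Q $ 3 - 1 / 2), Q $ 3 - 1 / 2]"

text \<open>The affine chart with exceptional divisor \<open>p = 0\<close> of the blow-up in the point
  \<open>(0, b, c)\<close>, respectively in the curve \<open>p = 0, q = g r\<close>.\<close>

definition blowup_point :: "complex \<Rightarrow> complex \<Rightarrow> c3 \<Rightarrow> c3" where
  "blowup_point b c P = (let p = P $ 1; q = P $ 2; r = P $ 3 in
     vector [p, (q - b) / p, (r - c) / p])"

definition blowup_curve :: "(complex \<Rightarrow> complex) \<Rightarrow> c3 \<Rightarrow> c3" where
  "blowup_curve g P = (let p = P $ 1; q = P $ 2; r = P $ 3 in
     vector [p, (q - g r) / p, r])"

definition resolution_chart :: "complex \<Rightarrow> complex \<Rightarrow> c3 \<Rightarrow> c3" where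
  "resolution_chart \<epsilon> s =
     blowup_curve (\<lambda>r. - (4 * \<epsilon> / 3) * r - 4 * \<epsilon> / 9 * (\<epsilon> ^ 2 - 3))
     \<circ> blowup_curve (\<lambda>r. s * \<i> / 3 * (\<epsilon> ^ 2 - 3))
     \<circ> blowup_point (- \<epsilon> / 3) (- (2 * s * \<i> * \<epsilon> / 3))
     \<circ> blowup_point 0 0
     \<circ> local_coords s
     \<circ> boundary_chart"

definition equal_up_to_signs_on :: "c3 set \<Rightarrow> (c3 \<Rightarrow> c3) \<Rightarrow> (c3 \<Rightarrow> c3) \<Rightarrow> bool" where
  "equal_up_to_signs_on S f g \<longleftrightarrow> (\<exists>\<sigma> :: 3 \<Rightarrow> complex. (\<forall>k. \<sigma> k = 1 \<or> \<sigma> k = - 1) \<and>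
     (\<forall>p\<in>S. \<forall>k. f p $ k = \<sigma> k * g p $ k))"

section \<open>The phase space\<close>

text \<open>The locus of the original space on which the \<open>j\<close>-th coordinates are defined.\<close>

definition overlap :: "nat \<Rightarrow> c3 set" where
  "overlap j = (if j = 0 then UNIV else {p. p $ 1 \<noteq> 0})"

text \<open>Gluing the copies of affine space along the coordinates \<open>\<phi> 0\<close>, \<open>\<phi> 1\<close>, \<open>\<phi> 2\<close> gives the
  phase space: \<open>\<phi> 0\<close> are the original coordinates, \<open>\<phi> 1\<close> and \<open>\<phi> 2\<close> those of the final
  charts of the resolutions of the two accessible singular points, and the vector field
  extends regularly.\<close>

definition is_phase_space :: "complex \<Rightarrow> (nat \<Rightarrow> c3 \<Rightarrow> c3) \<Rightarrow> bool" where
  "is_phase_space \<epsilon> \<phi> \<longleftrightarrow>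
     accessible_singular_point (system_field \<epsilon>) (sing_point 1) \<and>
     accessible_singular_point (system_field \<epsilon>) (sing_point (- 1)) \<and>
     (\<forall>p. \<phi> 0 p = p) \<and>
     equal_up_to_signs_on (overlap 1) (\<phi> 1) (resolution_chart \<epsilon> 1) \<and>
     equal_up_to_signs_on (overlap 2) (\<phi> 2) (resolution_chart \<epsilon> (- 1)) \<and>
     equiv ({0, 1, 2} \<times> UNIV) (glue_rel {0, 1, 2} overlap \<phi>) \<and>
     complex_threefold (glue_space {0, 1, 2} overlap \<phi>) {0, 1, 2}
       (glue_inj {0, 1, 2} overlap \<phi>) \<and>
     (\<forall>j\<in>{0, 1, 2}. polynomial_in_chart (system_field \<epsilon>) (overlap j) (\<phi> j))"

definition U1_coords :: "complex \<Rightarrow> c3 \<Rightarrow> c3" where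
  "U1_coords \<epsilon> p = (let x = p $ 1; y = p $ 2; z = p $ 3 in
     vector [1 / x,
       - ((y - \<epsilon> / 3 * x - \<i> * z + \<i> * (5 * \<epsilon> ^ 2 + 9) / 9) * x
           + 4 * \<epsilon> / 9 * (3 * z + \<epsilon> ^ 2 - 3)) * x,
       z - 1 / 6 * (3 * x - 4 * \<i> * \<epsilon>) * x])"

definition U2_coords :: "complex \<Rightarrow> c3 \<Rightarrow> c3" where
  "U2_coords \<epsilon> p = (let x = p $ 1; y = p $ 2; z = p $ 3 in
     vector [1 / x,
       - ((y - \<epsilon> / 3 * x + \<i> * z - \<i> * (5 * \<epsilon> ^ 2 + 9) / 9) * x
           + 4 * \<epsilon> / 9 * (3 * z + \<epsilon> ^ 2 - 3)) * x,
       z - 1 / 6 * (3 * x + 4 * \<i> * \<epsilon>) * x])"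

definition U_coords :: "complex \<Rightarrow> nat \<Rightarrow> c3 \<Rightarrow> c3" where
  "U_coords \<epsilon> j = (if j = 0 then (\<lambda>p. p) else if j = 1 then U1_coords \<epsilon> else U2_coords \<epsilon>)"

end

theory Submission
  imports Defs
begin

text \<open>
  The two charts at infinity are the same formula \<open>final_chart\<close> for the signs \<open>s = 1\<close> and
  \<open>s = - 1\<close>, so each property is proved once from \<open>s ^ 2 = 1\<close>.

  On \<open>x \<noteq> 0\<close> the chart is triangular: its first coordinate is \<open>1 / x\<close>, the third is
  \<open>z\<close> plus a polynomial in \<open>x\<close>, and the second is \<open>- (x ^ 2) * y\<close> plus a polynomial in
  \<open>x\<close> and \<open>z\<close>. It can therefore be solved for \<open>x\<close>, then \<open>z\<close>, then \<open>y\<close>,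
  which gives a rational inverse, and its Jacobian determinant is
  \<open>(- 1 / x ^ 2) * (- (x ^ 2)) = 1\<close> (\<open>wedge3_final_chart\<close>). Composing the blow-ups gives the
  same map up to one sign (\<open>resolution_chart_eq\<close>).

  Regularity of the vector field on the new charts is the cancellation of all negative powers of
  \<open>u = 1 / x\<close>. It rests on the identity \<open>dx/dt = s * \<i> / 2 * x ^ 2 + G\<close> with \<open>G\<close>
  polynomial in the new coordinates: the first and third velocities follow from it at once, and the
  second becomes a polynomial identity modulo \<open>(s * \<i>) ^ 2 = - 1\<close>
  (\<open>chart_velocity_identities\<close>).

  That the glued space is a complex threefold is a general fact about gluing copies of affine space
  along biholomorphic maps between open subsets (\<open>complex_threefold_glue_space\<close>). The quotient
  map is open, so each copy embeds as an open set, and the space is Hausdorff as soon as every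
  transition relation is closed in the product of the two full copies. Here the relations are
  cut out by polynomial equations. Between the original space and a new chart one of them is
  \<open>x * u = 1\<close>, which excludes \<open>u = 0\<close>. Between the two new charts the difference of the
  second coordinates has a pole of exact order four along \<open>u = 0\<close>, whatever \<open>\<epsilon>\<close> is, so
  the points on the two exceptional divisors stay separated (\<open>closed_graph_final_charts\<close>).
\<close>

section \<open>Polynomial and rational functions\<close>

definition monomial3 :: "nat \<times> nat \<times> nat \<Rightarrow> c3 \<Rightarrow> complex" where
  "monomial3 t p = (case t of (i, j, k) \<Rightarrow> (p $ 1) ^ i * (p $ 2) ^ j * (p $ 3) ^ k)"

text \<open>A box of exponents is awkward for products, because its size changes. Arbitrary finite sets of
exponents describe the same functions and are closed under unions, which makes addition a union
of supports and reduces multiplication to single monomials.\<close>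

lemma polynomial3_iff_sum_monomials:
  "polynomial3 f \<longleftrightarrow> (\<exists>A c. finite A \<and> f = (\<lambda>p. \<Sum>t\<in>A. c t * monomial3 t p))"
proof
  assume "polynomial3 f"
  then obtain N c where f: "\<And>p. f p =
      (\<Sum>i\<le>N. \<Sum>j\<le>N. \<Sum>k\<le>N. c i j k * (p $ 1) ^ i * (p $ 2) ^ j * (p $ 3) ^ k)"
    unfolding polynomial3_def by blast
  let ?A = "{..N::nat} \<times> {..N::nat} \<times> {..N::nat}"
  let ?c = "\<lambda>(i, j, k). c i j k"
  have "f = (\<lambda>p. \<Sum>t\<in>?A. ?c t * monomial3 t p)"
    by (auto simp: fun_eq_iff f sum.cartesian_product monomial3_def case_prod_unfold mult.assoc)
  then show "\<exists>A c. finite A \<and> f = (\<lambda>p. \<Sum>t\<in>A. c t * monomial3 t p)"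
    by (intro exI[of _ ?A] exI[of _ ?c]) simp
next
  assume "\<exists>A c. finite A \<and> f = (\<lambda>p. \<Sum>t\<in>A. c t * monomial3 t p)"
  then obtain A c where A: "finite A" and f: "f = (\<lambda>p. \<Sum>t\<in>A. c t * monomial3 t p)"
    by blast
  define N where "N = Max (insert 0 ((\<lambda>(i, j, k). max i (max j k)) ` A))"
  have "max i (max j k) \<le> N" if "(i, j, k) \<in> A" for i j k
    unfolding N_def using A that by (intro Max_ge) force+
  then have sub: "A \<subseteq> {..N} \<times> {..N} \<times> {..N}"
    by fastforce
  define d where "d = (\<lambda>i j k. if (i, j, k) \<in> A then c (i, j, k) else 0)"
  have "f p = (\<Sum>i\<le>N. \<Sum>j\<le>N. \<Sum>k\<le>N. d i j k * (p $ 1) ^ i * (p $ 2) ^ j * (p $ 3) ^ k)" for p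
  proof -
    have "f p = (\<Sum>t\<in>A. (case t of (i, j, k) \<Rightarrow> d i j k) * monomial3 t p)"
      unfolding f d_def by (intro sum.cong) auto
    also have "\<dots> = (\<Sum>t\<in>{..N} \<times> {..N} \<times> {..N}. (case t of (i, j, k) \<Rightarrow> d i j k) * monomial3 t p)"
      using sub by (intro sum.mono_neutral_left) (auto simp: d_def)
    finally show ?thesis
      by (simp add: sum.cartesian_product monomial3_def case_prod_unfold mult.assoc)
  qed
  then show "polynomial3 f"
    unfolding polynomial3_def by blast
qed

lemma polynomial3_monomial: "polynomial3 (\<lambda>p. c * monomial3 t p)"
  unfolding polynomial3_iff_sum_monomials
  by (rule exI[of _ "{t}"], rule exI[of _ "\<lambda>_. c"]) simp

lemma polynomial3_const: "polynomial3 (\<lambda>p. c)"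
  using polynomial3_monomial[of c "(0, 0, 0)"] by (simp add: monomial3_def)

lemma polynomial3_coord: "polynomial3 (\<lambda>p. p $ k)"
proof -
  have "polynomial3 (\<lambda>p. p $ 1)" "polynomial3 (\<lambda>p. p $ 2)" "polynomial3 (\<lambda>p. p $ 3)"
    using polynomial3_monomial[of 1 "(1, 0, 0)"] polynomial3_monomial[of 1 "(0, 1, 0)"]
      polynomial3_monomial[of 1 "(0, 0, 1)"] by (simp_all add: monomial3_def)
  then have "\<forall>k. polynomial3 (\<lambda>p. p $ k)"
    by (simp add: forall_3)
  then show ?thesis ..
qed

lemma polynomial3_add:
  assumes "polynomial3 f" "polynomial3 g"
  shows "polynomial3 (\<lambda>p. f p + g p)"
proof -
  obtain A c where A: "finite A" and f: "f = (\<lambda>p. \<Sum>t\<in>A. c t * monomial3 t p)"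
    using assms(1) unfolding polynomial3_iff_sum_monomials by blast
  obtain B d where B: "finite B" and g: "g = (\<lambda>p. \<Sum>t\<in>B. d t * monomial3 t p)"
    using assms(2) unfolding polynomial3_iff_sum_monomials by blast
  define e where "e = (\<lambda>t. (if t \<in> A then c t else 0) + (if t \<in> B then d t else 0))"
  have "f p + g p = (\<Sum>t\<in>A \<union> B. e t * monomial3 t p)" for p
  proof -
    have "f p = (\<Sum>t\<in>A \<union> B. (if t \<in> A then c t else 0) * monomial3 t p)"
      unfolding f using A B by (intro sum.mono_neutral_cong_left) auto
    moreover have "g p = (\<Sum>t\<in>A \<union> B. (if t \<in> B then d t else 0) * monomial3 t p)"
      unfolding g using A B by (intro sum.mono_neutral_cong_left) auto
    ultimately show ?thesis
      by (simp add: e_def ring_distribs sum.distrib)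
  qed
  then show ?thesis
    unfolding polynomial3_iff_sum_monomials using A B by blast
qed

lemma polynomial3_sum:
  assumes "\<And>i. i \<in> A \<Longrightarrow> polynomial3 (f i)"
  shows "polynomial3 (\<lambda>p. \<Sum>i\<in>A. f i p)"
  using assms
  by (induction A rule: infinite_finite_induct) (auto intro: polynomial3_const polynomial3_add)

lemma polynomial3_mult:
  assumes "polynomial3 f" "polynomial3 g"
  shows "polynomial3 (\<lambda>p. f p * g p)"
proof -
  obtain A c where f: "f = (\<lambda>p. \<Sum>t\<in>A. c t * monomial3 t p)"
    using assms(1) unfolding polynomial3_iff_sum_monomials by blast
  obtain B d where g: "g = (\<lambda>p. \<Sum>t\<in>B. d t * monomial3 t p)"
    using assms(2) unfolding polynomial3_iff_sum_monomials by blast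
  have mono: "polynomial3 (\<lambda>p. (c t * monomial3 t p) * (d u * monomial3 u p))" for t u
  proof -
    obtain i j k i' j' k' where "t = (i, j, k)" "u = (i', j', k')"
      by (metis prod_cases3)
    then have "(\<lambda>p. (c t * monomial3 t p) * (d u * monomial3 u p)) =
        (\<lambda>p. (c t * d u) * monomial3 (i + i', j + j', k + k') p)"
      by (auto simp: monomial3_def power_add)
    then show ?thesis
      by (simp add: polynomial3_monomial)
  qed
  show ?thesis
    unfolding f g sum_product by (intro polynomial3_sum mono)
qed

lemma polynomial3_minus: "polynomial3 f \<Longrightarrow> polynomial3 (\<lambda>p. - f p)"
  using polynomial3_mult[OF polynomial3_const[of "- 1"]] by simp

lemma polynomial3_diff: "polynomial3 f \<Longrightarrow> polynomial3 g \<Longrightarrow> polynomial3 (\<lambda>p. f p - g p)"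
  using polynomial3_add[OF _ polynomial3_minus, of f g] by simp

lemma polynomial3_power: "polynomial3 f \<Longrightarrow> polynomial3 (\<lambda>p. f p ^ n)"
  by (induction n) (auto intro: polynomial3_const polynomial3_mult)

lemma polynomial3_divide_const: "polynomial3 f \<Longrightarrow> polynomial3 (\<lambda>p. f p / c)"
  using polynomial3_mult[OF _ polynomial3_const[of "inverse c"]] by (simp add: field_simps)

lemmas polynomial3_intros = polynomial3_const polynomial3_coord polynomial3_add polynomial3_mult
  polynomial3_minus polynomial3_diff polynomial3_power polynomial3_divide_const

text \<open>One coordinate of \<open>rational_on3\<close>. Unlike the vector-valued notion it has closure rules for sums
and products, so a polynomial in \<open>1 / p $ k\<close> is rational without a common denominator being
written down.\<close>

definition rational_fun3 :: "c3 set \<Rightarrow> (c3 \<Rightarrow> complex) \<Rightarrow> bool" where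
  "rational_fun3 S f \<longleftrightarrow>
     (\<exists>g h. polynomial3 g \<and> polynomial3 h \<and> (\<forall>p\<in>S. h p \<noteq> 0 \<and> f p = g p / h p))"

lemma polynomial3_imp_rational_fun3: "polynomial3 f \<Longrightarrow> rational_fun3 S f"
  unfolding rational_fun3_def
  by (intro exI[of _ f] exI[of _ "\<lambda>_. 1"]) (simp add: polynomial3_const)

lemma rational_fun3_add:
  assumes "rational_fun3 S f" "rational_fun3 S f'"
  shows "rational_fun3 S (\<lambda>p. f p + f' p)"
proof -
  obtain g h g' h' where "polynomial3 g" "polynomial3 h" "polynomial3 g'" "polynomial3 h'"
    and "\<And>p. p \<in> S \<Longrightarrow> h p \<noteq> 0 \<and> f p = g p / h p" "\<And>p. p \<in> S \<Longrightarrow> h' p \<noteq> 0 \<and> f' p = g' p / h' p"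
    using assms unfolding rational_fun3_def by blast
  then show ?thesis
    unfolding rational_fun3_def
    by (intro exI[of _ "\<lambda>p. g p * h' p + g' p * h p"] exI[of _ "\<lambda>p. h p * h' p"])
      (simp add: polynomial3_intros add_frac_eq)
qed

lemma rational_fun3_mult:
  assumes "rational_fun3 S f" "rational_fun3 S f'"
  shows "rational_fun3 S (\<lambda>p. f p * f' p)"
proof -
  obtain g h g' h' where "polynomial3 g" "polynomial3 h" "polynomial3 g'" "polynomial3 h'"
    and "\<And>p. p \<in> S \<Longrightarrow> h p \<noteq> 0 \<and> f p = g p / h p" "\<And>p. p \<in> S \<Longrightarrow> h' p \<noteq> 0 \<and> f' p = g' p / h' p"
    using assms unfolding rational_fun3_def by blast
  then show ?thesis
    unfolding rational_fun3_def
    by (intro exI[of _ "\<lambda>p. g p * g' p"] exI[of _ "\<lambda>p. h p * h' p"])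
      (simp add: polynomial3_intros)
qed

lemma rational_fun3_inverse_coord:
  assumes "\<And>p. p \<in> S \<Longrightarrow> p $ k \<noteq> 0"
  shows "rational_fun3 S (\<lambda>p. 1 / p $ k)"
  unfolding rational_fun3_def
  by (intro exI[of _ "\<lambda>_. 1"] exI[of _ "\<lambda>p. p $ k"]) (simp add: assms polynomial3_intros)

lemma rational_on3_iff: "rational_on3 S f \<longleftrightarrow> (\<forall>k. rational_fun3 S (\<lambda>p. f p $ k))"
  by (simp add: rational_on3_def rational_fun3_def)

section \<open>Complex gradients and holomorphy\<close>

text \<open>The bilinear pairing \<open>\<Sum>k. g $ k * h $ k\<close> without conjugation makes the derivative
complex linear, so a complex gradient is a row of the Jacobian matrix that \<open>holomorphic3\<close>
asks for.\<close>

definition has_gradient :: "(c3 \<Rightarrow> complex) \<Rightarrow> c3 \<Rightarrow> c3 \<Rightarrow> bool" where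
  "has_gradient f g p \<longleftrightarrow> (f has_derivative (\<lambda>h. \<Sum>k\<in>UNIV. g $ k * h $ k)) (at p)"

lemma has_gradient_const: "has_gradient (\<lambda>p. c) 0 p"
  by (simp add: has_gradient_def)

lemma has_gradient_coord: "has_gradient (\<lambda>p. p $ k) (axis k 1) p"
proof -
  have "(\<lambda>h::c3. \<Sum>i\<in>UNIV. axis k 1 $ i * h $ i) = (\<lambda>h. h $ k)"
    by (simp add: axis_def if_distrib[of "\<lambda>x. x * _"] cong: if_cong)
  then show ?thesis
    by (simp add: has_gradient_def bounded_linear_imp_has_derivative bounded_linear_vec_nth)
qed

lemma has_gradient_add:
  assumes "has_gradient f g p" "has_gradient f' g' p"
  shows "has_gradient (\<lambda>p. f p + f' p) (g + g') p"
  using has_derivative_add[OF assms[unfolded has_gradient_def]]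
  by (simp add: has_gradient_def ring_distribs sum.distrib)

lemma has_gradient_mult:
  assumes "has_gradient f g p" "has_gradient f' g' p"
  shows "has_gradient (\<lambda>p. f p * f' p) (f p *s g' + f' p *s g) p"
  using has_derivative_mult[OF assms[unfolded has_gradient_def]]
  by (simp add: has_gradient_def algebra_simps sum.distrib sum_distrib_left)

lemma has_gradient_divide:
  assumes "has_gradient f g p" "has_gradient f' g' p" "f' p \<noteq> 0"
  shows "has_gradient (\<lambda>p. f p / f' p) ((1 / f' p) *s g - (f p / f' p ^ 2) *s g') p"
  using has_derivative_divide'[OF assms(1,2)[unfolded has_gradient_def] assms(3)] assms(3)
  by (simp add: has_gradient_def field_simps sum_subtractf sum_distrib_left
      power2_eq_square flip: sum_divide_distrib)

lemma has_gradient_vector: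
  fixes f :: "c3 \<Rightarrow> c3"
  assumes "\<And>k. has_gradient (\<lambda>q. f q $ k) (G k) p"
  shows "(f has_derivative (\<lambda>h. (\<chi> k. G k) *v h)) (at p)"
proof (subst has_derivative_componentwise_within, intro ballI)
  fix b :: c3
  assume "b \<in> Basis"
  then obtain k u where b: "b = axis k u"
    by (auto simp: Basis_vec_def)
  have "((\<lambda>q. f q $ k) has_derivative (\<lambda>h. ((\<chi> k. G k) *v h) $ k)) (at p)"
    using assms[of k] by (simp add: has_gradient_def matrix_vector_mult_def)
  from has_derivative_inner_left[OF this, of u]
  show "((\<lambda>q. f q \<bullet> b) has_derivative (\<lambda>h. ((\<chi> k. G k) *v h) \<bullet> b)) (at p)"
    by (simp add: b inner_axis)
qed

lemma polynomial3_has_gradient: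
  assumes "polynomial3 f"
  shows "\<exists>g. has_gradient f g p"
proof -
  have pow: "\<exists>g. has_gradient (\<lambda>p. (p $ k) ^ n) g p" for k n
  proof (induction n)
    case 0
    then show ?case by (auto intro: has_gradient_const)
  next
    case (Suc n)
    then show ?case
      by (auto intro: has_gradient_mult[OF has_gradient_coord])
  qed
  have mono: "\<exists>g. has_gradient (\<lambda>p. c * monomial3 t p) g p" for c t
  proof -
    obtain i j k where t: "t = (i, j, k)" by (metis prod_cases3)
    obtain a b d where "has_gradient (\<lambda>p. p $ 1 ^ i) a p"
      "has_gradient (\<lambda>p. p $ 2 ^ j) b p" "has_gradient (\<lambda>p. p $ 3 ^ k) d p"
      using pow by metis
    from has_gradient_mult[OF has_gradient_const[of c]
        has_gradient_mult[OF has_gradient_mult[OF this(1,2)] this(3)]]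
    show ?thesis by (auto simp: monomial3_def t)
  qed
  obtain A c where A: "finite A" and f: "f = (\<lambda>p. \<Sum>t\<in>A. c t * monomial3 t p)"
    using assms unfolding polynomial3_iff_sum_monomials by blast
  show ?thesis
    unfolding f using A
  proof induction
    case empty
    then show ?case by (auto intro: has_gradient_const)
  next
    case (insert t A)
    then obtain g where "has_gradient (\<lambda>p. \<Sum>t\<in>A. c t * monomial3 t p) g p" by blast
    moreover obtain g' where "has_gradient (\<lambda>p. c t * monomial3 t p) g' p"
      using mono by blast
    ultimately show ?case
      using insert.hyps by (auto intro: has_gradient_add)
  qed
qed

text \<open>All coordinate changes below are rational, so their holomorphy comes from the closure of complex
differentiability under sums, products and quotients.\<close>

lemma rational_on3_imp_holomorphic3:
  assumes "rational_on3 S f" "open S"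
  shows "holomorphic3 f S"
  unfolding holomorphic3_def
proof (intro conjI ballI assms(2))
  fix p assume p: "p \<in> S"
  have "\<exists>G. has_gradient (\<lambda>q. f q $ k) G p" for k
  proof -
    obtain g h where "polynomial3 g" "polynomial3 h" and gh: "\<And>q. q \<in> S \<Longrightarrow> h q \<noteq> 0 \<and> f q $ k = g q / h q"
      using assms(1) unfolding rational_on3_def by blast
    then obtain G H where "has_gradient g G p" "has_gradient h H p"
      by (meson polynomial3_has_gradient)
    then obtain K where K: "has_gradient (\<lambda>q. g q / h q) K p"
      using gh[OF p] has_gradient_divide by blast
    have "has_gradient (\<lambda>q. f q $ k) K p"
      unfolding has_gradient_def
      by (rule has_derivative_transform_within_open[OF K[unfolded has_gradient_def] assms(2) p])
        (simp add: gh)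
    then show ?thesis ..
  qed
  then obtain G where "\<And>k. has_gradient (\<lambda>q. f q $ k) (G k) p"
    by metis
  then show "\<exists>A :: complex ^ 3 ^ 3. (f has_derivative (\<lambda>h. A *v h)) (at p)"
    using has_gradient_vector by blast
qed

lemma holomorphic3_imp_continuous_on: "holomorphic3 f S \<Longrightarrow> continuous_on S f"
  unfolding holomorphic3_def
  by (meson continuous_at_imp_continuous_on has_derivative_continuous)

lemma holomorphic3_compose:
  assumes "holomorphic3 f S" "holomorphic3 g T" "f ` S \<subseteq> T"
  shows "holomorphic3 (\<lambda>a. g (f a)) S"
  unfolding holomorphic3_def
proof (intro conjI ballI)
  show "open S" using assms(1) by (simp add: holomorphic3_def)
  fix p assume "p \<in> S"
  then obtain A B :: "complex ^ 3 ^ 3" where A: "(f has_derivative (\<lambda>h. A *v h)) (at p)"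
    and B: "(g has_derivative (\<lambda>h. B *v h)) (at (f p))"
    using assms unfolding holomorphic3_def by blast
  have "((\<lambda>a. g (f a)) has_derivative (\<lambda>h. B *v (A *v h))) (at p)"
    using has_derivative_compose[OF A B] .
  then show "\<exists>C :: complex ^ 3 ^ 3. ((\<lambda>a. g (f a)) has_derivative (\<lambda>h. C *v h)) (at p)"
    by (auto simp: matrix_vector_mul_assoc)
qed

lemma holomorphic3_cong:
  assumes "holomorphic3 f S" "\<And>a. a \<in> S \<Longrightarrow> g a = f a"
  shows "holomorphic3 g S"
  using assms unfolding holomorphic3_def
  by (metis has_derivative_transform_within_open)

lemma holomorphic3_subset: "holomorphic3 f S \<Longrightarrow> open T \<Longrightarrow> T \<subseteq> S \<Longrightarrow> holomorphic3 f T"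
  unfolding holomorphic3_def by blast

lemma holomorphic3_ident: "open S \<Longrightarrow> holomorphic3 (\<lambda>a. a) S"
  unfolding holomorphic3_def
  by (metis has_derivative_ident matrix_vector_mul_lid has_derivative_eq_rhs ext)

section \<open>Gluing affine spaces\<close>

text \<open>The coordinates \<open>\<phi> i\<close> are biholomorphic from \<open>D i\<close> onto an open part of the
\<open>i\<close>-th copy, with inverse \<open>\<psi> i\<close>. The copy may be strictly larger than this part: the
remaining points are those that the gluing adds. Closedness of the graph of each transition
relation, as a subset of the product of the two whole copies, is what makes the glued space
separated.\<close>

locale affine_gluing =
  fixes I :: "'i set" and D :: "'i \<Rightarrow> c3 set" and \<phi> \<psi> :: "'i \<Rightarrow> c3 \<Rightarrow> c3"
  assumes countable_I: "countable I"
    and left_inverse: "\<And>i p. i \<in> I \<Longrightarrow> p \<in> D i \<Longrightarrow> \<psi> i (\<phi> i p) = p"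
    and holo: "\<And>i. i \<in> I \<Longrightarrow> holomorphic3 (\<phi> i) (D i)"
    and holo_inverse: "\<And>i. i \<in> I \<Longrightarrow> holomorphic3 (\<psi> i) (\<phi> i ` D i)"
    and closed_graph: "\<And>i j. i \<in> I \<Longrightarrow> j \<in> I \<Longrightarrow> i \<noteq> j \<Longrightarrow>
      closed ((\<lambda>p. (\<phi> i p, \<phi> j p)) ` (D i \<inter> D j))"
begin

abbreviation R where "R \<equiv> glue_rel I D \<phi>"
abbreviation X where "X \<equiv> glue_space I D \<phi>"
abbreviation \<iota> where "\<iota> \<equiv> glue_inj I D \<phi>"

text \<open>Transitivity is the only point with content: two identifications that meet in the \<open>j\<close>-th copy
come from the same reference point because \<open>\<phi> j\<close> is injective on \<open>D j\<close>.\<close>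

lemma equiv_glue_rel: "equiv (I \<times> UNIV) R"
proof (rule equivI)
  show "R \<subseteq> (I \<times> UNIV) \<times> I \<times> UNIV"
    by (auto simp: glue_rel_def)
  show "refl_on (I \<times> UNIV) R"
    by (auto simp: refl_on_def glue_rel_def)
  show "sym R"
    by (auto simp: sym_def glue_rel_def)
  show "trans R"
  proof (rule transI)
    fix x y z assume xy: "(x, y) \<in> R" and yz: "(y, z) \<in> R"
    obtain i a j b k c where eqs: "x = (i, a)" "y = (j, b)" "z = (k, c)"
      by (metis surj_pair)
    from xy yz have I: "i \<in> I" "j \<in> I" "k \<in> I"
      by (auto simp: glue_rel_def eqs)
    show "(x, z) \<in> R"
    proof (cases "x = y \<or> y = z")
      case True
      then show ?thesis using xy yz by auto
    next
      case False
      then obtain p q where p: "p \<in> D i \<inter> D j" "\<phi> i p = a" "\<phi> j p = b"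
        and q: "q \<in> D j \<inter> D k" "\<phi> j q = b" "\<phi> k q = c"
        using xy yz by (auto simp: glue_rel_def eqs)
      then have "p = q"
        using left_inverse[OF I(2)] by (metis IntD1 IntD2)
      then show ?thesis
        using p q I by (auto simp: glue_rel_def eqs)
    qed
  qed
qed

lemma glue_inj_eq_iff:
  assumes "i \<in> I" "j \<in> I"
  shows "\<iota> i a = \<iota> j b \<longleftrightarrow> ((i, a), (j, b)) \<in> R"
  unfolding glue_inj_def using eq_equiv_class_iff[OF equiv_glue_rel] assms by simp

lemma glue_inj_eq_same: "i \<in> I \<Longrightarrow> \<iota> i a = \<iota> i b \<longleftrightarrow> a = b"
  by (auto simp: glue_inj_eq_iff glue_rel_def)

lemma glue_inj_eq_other:
  assumes "i \<in> I" "j \<in> I" "i \<noteq> j"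
  shows "\<iota> i a = \<iota> j b \<longleftrightarrow> (a, b) \<in> (\<lambda>p. (\<phi> i p, \<phi> j p)) ` (D i \<inter> D j)"
  using assms by (auto simp: glue_inj_eq_iff glue_rel_def)

lemma glue_inj_eq_transition:
  assumes "i \<in> I" "j \<in> I" "i \<noteq> j"
  shows "\<iota> i a = \<iota> j b \<longleftrightarrow> a \<in> \<phi> i ` D i \<and> \<psi> i a \<in> D j \<and> b = \<phi> j (\<psi> i a)"
proof
  assume "\<iota> i a = \<iota> j b"
  then obtain p where "p \<in> D i" "p \<in> D j" "a = \<phi> i p" "b = \<phi> j p"
    by (auto simp: glue_inj_eq_other[OF assms])
  then show "a \<in> \<phi> i ` D i \<and> \<psi> i a \<in> D j \<and> b = \<phi> j (\<psi> i a)"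
    by (simp add: left_inverse[OF assms(1)])
next
  assume r: "a \<in> \<phi> i ` D i \<and> \<psi> i a \<in> D j \<and> b = \<phi> j (\<psi> i a)"
  then obtain p where "p \<in> D i" "a = \<phi> i p" by blast
  with r have "p \<in> D i \<inter> D j" "(a, b) = (\<phi> i p, \<phi> j p)"
    by (simp_all add: left_inverse[OF assms(1)])
  then show "\<iota> i a = \<iota> j b"
    unfolding glue_inj_eq_other[OF assms] by (rule rev_image_eqI)
qed

lemma quotient_eq_Union_charts: "(I \<times> UNIV) // R = (\<Union>j\<in>I. range (\<iota> j))"
  by (auto simp: quotient_def glue_inj_def)

lemma openin_glue_iff:
  "openin X W \<longleftrightarrow> W \<subseteq> (\<Union>j\<in>I. range (\<iota> j)) \<and> (\<forall>j\<in>I. open (\<iota> j -` W))"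
proof -
  have "{a. (j, a) \<in> {x \<in> I \<times> UNIV. R `` {x} \<in> W}} = \<iota> j -` W" if "j \<in> I" for j
    using that by (auto simp: glue_inj_def)
  moreover have "{x \<in> I \<times> UNIV. R `` {x} \<in> W} \<subseteq> Sigma I (topspace \<circ> (\<lambda>_. euclidean))"
    by auto
  ultimately show ?thesis
    unfolding openin_glue_space quotient_eq_Union_charts openin_sum_topology
    by (simp add: open_openin[symmetric])
qed

lemma topspace_glue_space: "topspace X = (\<Union>j\<in>I. range (\<iota> j))"
proof
  show "topspace X \<subseteq> (\<Union>j\<in>I. range (\<iota> j))"
    using openin_glue_iff[of "topspace X"] by simp
  have "\<iota> j -` (\<Union>j\<in>I. range (\<iota> j)) = UNIV" if "j \<in> I" for j
    using that by auto
  then show "(\<Union>j\<in>I. range (\<iota> j)) \<subseteq> topspace X"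
    by (intro openin_subset) (simp add: openin_glue_iff)
qed

lemma open_transition_domain:
  assumes "i \<in> I" "open V"
  shows "open {a \<in> \<phi> i ` D i. \<psi> i a \<in> V}"
proof -
  have "open (\<phi> i ` D i)"
    using holo_inverse[OF assms(1)] by (simp add: holomorphic3_def)
  from continuous_open_preimage[OF holomorphic3_imp_continuous_on[OF holo_inverse[OF assms(1)]] this assms(2)]
  show ?thesis
    by (simp add: vimage_def Collect_conj_eq Int_commute Collect_mem_eq)
qed

lemma open_chart_preimage:
  assumes "j \<in> I" "open V"
  shows "open {p \<in> D j. \<phi> j p \<in> V}"
proof -
  have "open (D j)"
    using holo[OF assms(1)] by (simp add: holomorphic3_def)
  from continuous_open_preimage[OF holomorphic3_imp_continuous_on[OF holo[OF assms(1)]] this assms(2)]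
  show ?thesis
    by (simp add: vimage_def Collect_conj_eq Int_commute Collect_mem_eq)
qed

text \<open>The quotient map is open: the trace of \<open>\<iota> j ` V\<close> on another copy is the preimage of the
open set \<open>V\<close> under a continuous transition map with open domain.\<close>

lemma openin_glue_inj_image:
  assumes j: "j \<in> I" and V: "open V"
  shows "openin X (\<iota> j ` V)"
  unfolding openin_glue_iff
proof (intro conjI ballI)
  show "\<iota> j ` V \<subseteq> (\<Union>j\<in>I. range (\<iota> j))" using j by auto
  fix i assume i: "i \<in> I"
  show "open (\<iota> i -` \<iota> j ` V)"
  proof (cases "i = j")
    case True
    then have "\<iota> i -` \<iota> j ` V = V"
      by (auto simp: glue_inj_eq_same[OF j])
    then show ?thesis using V by simp
  next
    case False
    have "\<iota> i -` \<iota> j ` V = {a \<in> \<phi> i ` D i. \<psi> i a \<in> {p \<in> D j. \<phi> j p \<in> V}}"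
      by (auto simp: glue_inj_eq_transition[OF i j False])
    then show ?thesis
      using open_transition_domain[OF i open_chart_preimage[OF j V]] by simp
  qed
qed

lemma embedding_glue_inj:
  assumes "j \<in> I"
  shows "embedding_map euclidean X (\<iota> j)"
proof (rule injective_open_imp_embedding_map)
  show "continuous_map euclidean X (\<iota> j)"
    using assms by (auto simp: continuous_map_def topspace_glue_space openin_glue_iff vimage_def)
  show "open_map euclidean X (\<iota> j)"
    using assms by (auto simp: open_map_def openin_glue_inj_image)
  show "inj_on (\<iota> j) (topspace euclidean)"
    using glue_inj_eq_same[OF assms] by (auto simp: inj_on_def)
qed

text \<open>The set of pairs \<open>(a, b)\<close> with \<open>\<iota> i a = \<iota> j b\<close> is closed: it is the diagonal for
\<open>i = j\<close>, and the graph of the transition relation otherwise. A product neighbourhood that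
avoids it projects to disjoint open sets.\<close>

lemma Hausdorff_glue_space: "Hausdorff_space X"
  unfolding Hausdorff_space_def
proof (intro allI impI)
  fix x y assume "x \<in> topspace X \<and> y \<in> topspace X \<and> x \<noteq> y"
  then obtain i a j b where i: "i \<in> I" "x = \<iota> i a" and j: "j \<in> I" "y = \<iota> j b" and ne: "\<iota> i a \<noteq> \<iota> j b"
    unfolding topspace_glue_space by blast
  define G where "G = {(a, b). \<iota> i a = \<iota> j b}"
  have "closed G"
  proof (cases "i = j")
    case True
    then have "G = range (\<lambda>a. (a, a))"
      using glue_inj_eq_same[OF i(1)] by (auto simp: G_def)
    then show ?thesis using closed_diagonal by (simp add: full_SetCompr_eq[symmetric])
  next
    case False
    then have "G = (\<lambda>p. (\<phi> i p, \<phi> j p)) ` (D i \<inter> D j)"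
      using glue_inj_eq_other[OF i(1) j(1)] by (auto simp: G_def)
    then show ?thesis using closed_graph[OF i(1) j(1) False] by simp
  qed
  moreover have "(a, b) \<in> - G" using ne by (simp add: G_def)
  ultimately obtain U V where UV: "open U" "open V" "a \<in> U" "b \<in> V" and sub: "U \<times> V \<subseteq> - G"
    by (metis open_Compl open_prod_elim mem_Sigma_iff)
  have "disjnt (\<iota> i ` U) (\<iota> j ` V)"
    using sub by (auto simp: disjnt_def G_def)
  then show "\<exists>U V. openin X U \<and> openin X V \<and> x \<in> U \<and> y \<in> V \<and> disjnt U V"
    using UV i j openin_glue_inj_image by blast
qed

lemma second_countable_glue_space: "second_countable X"
proof -
  obtain B :: "c3 set set" where B: "countable B" "topological_basis B"
    using ex_countable_basis by blast
  let ?B = "\<Union>j\<in>I. (\<lambda>V. \<iota> j ` V) ` B"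
  show ?thesis
    unfolding second_countable_def
  proof (intro exI[of _ ?B] conjI allI impI ballI)
    show "countable ?B" using B countable_I by blast
    show "openin X V" if "V \<in> ?B" for V
      using that openin_glue_inj_image topological_basis_open[OF B(2)] by auto
    fix W x assume W: "openin X W \<and> x \<in> W"
    then obtain j a where j: "j \<in> I" "x = \<iota> j a"
      using openin_glue_iff by blast
    with W have "open (\<iota> j -` W)" "a \<in> \<iota> j -` W"
      by (auto simp: openin_glue_iff)
    then obtain V where "V \<in> B" "a \<in> V" "V \<subseteq> \<iota> j -` W"
      by (meson B(2) topological_basisE)
    then show "\<exists>V\<in>?B. x \<in> V \<and> V \<subseteq> W"
      using j by blast
  qed
qed

lemma holomorphic_transition:
  assumes i: "i \<in> I" and j: "j \<in> I"
  shows "holomorphic3 (\<lambda>a. inv (\<iota> j) (\<iota> i a)) {a. \<iota> i a \<in> range (\<iota> j)}"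
proof -
  have inj: "inj (\<iota> j)"
    using glue_inj_eq_same[OF j] by (metis injI)
  show ?thesis
  proof (cases "i = j")
    case True
    have "{a. \<iota> i a \<in> range (\<iota> j)} = UNIV" "(\<lambda>a. inv (\<iota> j) (\<iota> i a)) = (\<lambda>a. a)"
      by (auto simp: True inv_f_f[OF inj])
    then show ?thesis by (simp only: holomorphic3_ident open_UNIV)
  next
    case False
    let ?S = "{a \<in> \<phi> i ` D i. \<psi> i a \<in> D j}"
    have S: "{a. \<iota> i a \<in> range (\<iota> j)} = ?S"
      by (auto simp: glue_inj_eq_transition[OF i j False])
    have "open ?S"
      using open_transition_domain[OF i] holo[OF j] by (simp add: holomorphic3_def)
    then have "holomorphic3 (\<psi> i) ?S"
      by (rule holomorphic3_subset[OF holo_inverse[OF i]]) auto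
    then have "holomorphic3 (\<lambda>a. \<phi> j (\<psi> i a)) ?S"
      by (rule holomorphic3_compose[OF _ holo[OF j]]) auto
    moreover have "inv (\<iota> j) (\<iota> i a) = \<phi> j (\<psi> i a)" if "a \<in> ?S" for a
    proof -
      have "\<iota> i a = \<iota> j (\<phi> j (\<psi> i a))"
        using that by (simp add: glue_inj_eq_transition[OF i j False])
      then show ?thesis by (simp add: inv_f_f[OF inj])
    qed
    ultimately show ?thesis
      unfolding S by (rule holomorphic3_cong)
  qed
qed

theorem complex_threefold_glue_space: "complex_threefold X I \<iota>"
  unfolding complex_threefold_def
  by (simp add: Hausdorff_glue_space second_countable_glue_space topspace_glue_space
      embedding_glue_inj openin_glue_inj_image holomorphic_transition)

end

section \<open>The final charts\<close>

text \<open>Both charts at infinity are instances of one formula, with \<open>s\<close> being \<open>1\<close> or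
\<open>-1\<close>, the sign that selects the accessible singular point.\<close>

definition final_chart :: "complex \<Rightarrow> complex \<Rightarrow> c3 \<Rightarrow> c3" where
  "final_chart \<epsilon> s p = (let x = p $ 1; y = p $ 2; z = p $ 3 in
     vector [1 / x,
       - ((y - \<epsilon> / 3 * x - s * \<i> * z + s * \<i> * (5 * \<epsilon> ^ 2 + 9) / 9) * x
           + 4 * \<epsilon> / 9 * (3 * z + \<epsilon> ^ 2 - 3)) * x,
       z - 1 / 6 * (3 * x - s * \<i> * (4 * \<epsilon>)) * x])"

definition final_chart_inverse :: "complex \<Rightarrow> complex \<Rightarrow> c3 \<Rightarrow> c3" where
  "final_chart_inverse \<epsilon> s a = (let u = a $ 1; x = 1 / u;
     z = a $ 3 + 1 / 6 * (3 * x - s * \<i> * (4 * \<epsilon>)) * x in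
     vector [x,
       s * \<i> * z - s * \<i> * (5 * \<epsilon> ^ 2 + 9) / 9 + \<epsilon> / 3 * x
         - (u * a $ 2 + 4 * \<epsilon> / 9 * (3 * z + \<epsilon> ^ 2 - 3)) * u,
       z])"

lemma U1_coords_eq: "U1_coords \<epsilon> = final_chart \<epsilon> 1"
  by (simp add: fun_eq_iff U1_coords_def final_chart_def Let_def mult.commute mult.left_commute)

lemma U2_coords_eq: "U2_coords \<epsilon> = final_chart \<epsilon> (- 1)"
  by (simp add: fun_eq_iff U2_coords_def final_chart_def Let_def mult.commute mult.left_commute)

lemma vec_eq_3: "(a::'a^3) = b \<longleftrightarrow> a $ 1 = b $ 1 \<and> a $ 2 = b $ 2 \<and> a $ 3 = b $ 3"
  by (simp add: vec_eq_iff forall_3)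

lemma final_chart_inverse_left:
  assumes "p $ 1 \<noteq> 0"
  shows "final_chart_inverse \<epsilon> s (final_chart \<epsilon> s p) = p"
  using assms by (simp add: vec_eq_3 final_chart_def final_chart_inverse_def Let_def)

lemma final_chart_inverse_right:
  assumes "a $ 1 \<noteq> 0"
  shows "final_chart \<epsilon> s (final_chart_inverse \<epsilon> s a) = a"
  using assms by (simp add: vec_eq_3 final_chart_def final_chart_inverse_def Let_def) (simp add: field_simps)

lemma final_chart_image: "final_chart \<epsilon> s ` {p. p $ 1 \<noteq> 0} = {a. a $ 1 \<noteq> 0}"
proof
  show "final_chart \<epsilon> s ` {p. p $ 1 \<noteq> 0} \<subseteq> {a. a $ 1 \<noteq> 0}"
    by (auto simp: final_chart_def Let_def)
  have "final_chart_inverse \<epsilon> s a $ 1 \<noteq> 0" if "a $ 1 \<noteq> 0" for a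
    using that by (simp add: final_chart_inverse_def Let_def)
  then show "{a. a $ 1 \<noteq> 0} \<subseteq> final_chart \<epsilon> s ` {p. p $ 1 \<noteq> 0}"
    by (auto intro!: image_eqI[of _ "final_chart \<epsilon> s", OF final_chart_inverse_right[symmetric]])
qed

lemma rational_final_chart: "rational_on3 {p. p $ 1 \<noteq> 0} (final_chart \<epsilon> s)"
  unfolding rational_on3_iff forall_3 final_chart_def Let_def vector_3
  using rational_fun3_inverse_coord[of "{p. p $ 1 \<noteq> 0}" 1]
  by (auto intro!: polynomial3_imp_rational_fun3 polynomial3_intros)

lemma rational_final_chart_inverse: "rational_on3 {a. a $ 1 \<noteq> 0} (final_chart_inverse \<epsilon> s)"
proof -
  let ?S = "{a :: c3. a $ 1 \<noteq> 0}"
  note intros = rational_fun3_add rational_fun3_mult polynomial3_imp_rational_fun3[OF polynomial3_const]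
    polynomial3_imp_rational_fun3[OF polynomial3_coord]
  have x: "rational_fun3 ?S (\<lambda>a. 1 / a $ 1)"
    by (rule rational_fun3_inverse_coord) simp
  have z: "rational_fun3 ?S (\<lambda>a. a $ 3 + 1 / 6 * (3 * (1 / a $ 1) + - (s * \<i> * (4 * \<epsilon>))) * (1 / a $ 1))"
    by (intro intros x)
  have "rational_fun3 ?S (\<lambda>a. s * \<i> * (a $ 3 + 1 / 6 * (3 * (1 / a $ 1) + - (s * \<i> * (4 * \<epsilon>))) * (1 / a $ 1))
      + - (s * \<i> * (5 * \<epsilon> ^ 2 + 9) / 9) + \<epsilon> / 3 * (1 / a $ 1)
      + (- 1) * ((a $ 1 * a $ 2 + 4 * \<epsilon> / 9 *
        (3 * (a $ 3 + 1 / 6 * (3 * (1 / a $ 1) + - (s * \<i> * (4 * \<epsilon>))) * (1 / a $ 1)) + (\<epsilon> ^ 2 - 3))) * a $ 1))"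
    by (intro intros x z)
  with x z show ?thesis
    unfolding rational_on3_iff forall_3 final_chart_inverse_def Let_def vector_3
    by (simp add: add_diff_eq)
qed

lemma open_nonzero_coord: "open {p :: c3. p $ 1 \<noteq> 0}"
  by (intro open_Collect_neq continuous_intros)

text \<open>The Jacobian matrix serves twice: it pushes the vector field forward, and its determinant gives
the volume form.\<close>

lemma final_chart_gradients:
  assumes "p $ 1 \<noteq> 0"
  defines "x \<equiv> p $ 1" and "y \<equiv> p $ 2" and "z \<equiv> p $ 3"
  shows "has_gradient (\<lambda>q. final_chart \<epsilon> s q $ 1) (vector [- 1 / x ^ 2, 0, 0]) p"
    and "has_gradient (\<lambda>q. final_chart \<epsilon> s q $ 2) (vector
      [- (2 * x * (y - \<epsilon> / 3 * x - s * \<i> * z + s * \<i> * (5 * \<epsilon> ^ 2 + 9) / 9) - \<epsilon> / 3 * x ^ 2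
         + 4 * \<epsilon> / 9 * (3 * z + \<epsilon> ^ 2 - 3)),
       - (x ^ 2), s * \<i> * x ^ 2 - 4 * \<epsilon> / 3 * x]) p"
    and "has_gradient (\<lambda>q. final_chart \<epsilon> s q $ 3) (vector [s * \<i> * (2 / 3 * \<epsilon>) - x, 0, 1]) p"
proof -
  have nth: "((\<lambda>q::c3. q $ k) has_derivative (\<lambda>h. h $ k)) (at p)" for k
    by (rule bounded_linear_imp_has_derivative[OF bounded_linear_vec_nth])
  note d = has_derivative_eq_rhs[OF nth] 
  show "has_gradient (\<lambda>q. final_chart \<epsilon> s q $ 1) (vector [- 1 / x ^ 2, 0, 0]) p"
    unfolding has_gradient_def final_chart_def Let_def vector_3 sum_3
    using assms(1) by (auto intro!: derivative_eq_intros d simp: fun_eq_iff x_def field_simps power2_eq_square)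
  show "has_gradient (\<lambda>q. final_chart \<epsilon> s q $ 2) (vector
      [- (2 * x * (y - \<epsilon> / 3 * x - s * \<i> * z + s * \<i> * (5 * \<epsilon> ^ 2 + 9) / 9) - \<epsilon> / 3 * x ^ 2
         + 4 * \<epsilon> / 9 * (3 * z + \<epsilon> ^ 2 - 3)),
       - (x ^ 2), s * \<i> * x ^ 2 - 4 * \<epsilon> / 3 * x]) p"
    unfolding has_gradient_def final_chart_def Let_def vector_3 sum_3
    by (auto intro!: derivative_eq_intros d simp: fun_eq_iff x_def y_def z_def field_simps power2_eq_square)
  show "has_gradient (\<lambda>q. final_chart \<epsilon> s q $ 3) (vector [s * \<i> * (2 / 3 * \<epsilon>) - x, 0, 1]) p"
    unfolding has_gradient_def final_chart_def Let_def vector_3 sum_3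
    by (auto intro!: derivative_eq_intros d simp: fun_eq_iff x_def field_simps power2_eq_square)
qed

lemma transport_nth:
  assumes "\<And>k. has_gradient (\<lambda>q. \<phi> q $ k) (G k) p"
  shows "transport \<phi> V p $ k = (\<Sum>j\<in>UNIV. G k $ j * V p $ j)"
  by (simp add: transport_def matrix_vector_mult_def flip: frechet_derivative_at[OF has_gradient_vector[OF assms]])

lemma transport_3:
  assumes "has_gradient (\<lambda>q. \<phi> q $ 1) g1 p" "has_gradient (\<lambda>q. \<phi> q $ 2) g2 p" "has_gradient (\<lambda>q. \<phi> q $ 3) g3 p"
  shows "transport \<phi> V p = vector [
    g1 $ 1 * V p $ 1 + g1 $ 2 * V p $ 2 + g1 $ 3 * V p $ 3,
    g2 $ 1 * V p $ 1 + g2 $ 2 * V p $ 2 + g2 $ 3 * V p $ 3,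
    g3 $ 1 * V p $ 1 + g3 $ 2 * V p $ 2 + g3 $ 3 * V p $ 3]"
proof -
  let ?G = "vector [g1, g2, g3] :: c3 ^ 3"
  have "\<forall>k. has_gradient (\<lambda>q. \<phi> q $ k) (?G $ k) p"
    using assms by (simp add: forall_3)
  then have "transport \<phi> V p $ k = (\<Sum>j\<in>UNIV. ?G $ k $ j * V p $ j)" for k
    by (intro transport_nth) auto
  then show ?thesis
    by (simp add: vec_eq_3 sum_3)
qed

section \<open>The vector field in the final charts\<close>

text \<open>With \<open>j = s * \<i>\<close>, the quantity \<open>G\<close> is \<open>dx/dt - j / 2 * x ^ 2\<close> written in the
coordinates \<open>u\<close>, \<open>v\<close>, \<open>w\<close>: the final chart is built so that subtracting this
leading term of \<open>dx/dt\<close> leaves a polynomial. The abbreviation \<open>E\<close> absorbs a shift of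
\<open>w\<close> under which the coefficients factor.\<close>

definition chart_field :: "complex \<Rightarrow> complex \<Rightarrow> c3 \<Rightarrow> c3" where
  "chart_field \<epsilon> s a = (let u = a $ 1; v = a $ 2; w = a $ 3; E = w + (\<epsilon> ^ 2 - 3) / 3;
     G = (s * \<i> - 4 * \<epsilon> / 3 * u) * E - v * u ^ 2 in
     vector [- (s * \<i> / 2) - u ^ 2 * G,
       s * \<i> * (4 / 3 * \<epsilon>) * E * (E + 8 / 9 * \<epsilon> ^ 2) - 16 / 9 * \<epsilon> ^ 2 * u * E ^ 2
         + v * (- (2 / 3 * \<epsilon>) + s * \<i> * 2 * u * (E + 4 / 9 * \<epsilon> ^ 2) - 4 * \<epsilon> * u ^ 2 * E)
         - 2 * u ^ 3 * v ^ 2,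
       s * \<i> * (2 / 3 * \<epsilon>) * G])"

lemma polynomial3_chart_field: "\<forall>k. polynomial3 (\<lambda>a. chart_field \<epsilon> s a $ k)"
  unfolding forall_3 chart_field_def Let_def vector_3 by (intro conjI polynomial3_intros)

text \<open>The chain rule in scalar form. The negative powers of \<open>u\<close> cancel only because
\<open>j ^ 2 = - 1\<close>. The left-hand sides have the shape of a row of the Jacobian matrix times the
velocity \<open>(x', y', z')\<close>, so zero and unit entries are kept.\<close>

lemma chart_velocity_identities:
  fixes x y z \<epsilon> j :: complex
  assumes x: "x \<noteq> 0" and j: "j ^ 2 = - 1"
  defines "u \<equiv> 1 / x"
    and "A \<equiv> y - \<epsilon> / 3 * x - j * z + j * (5 * \<epsilon> ^ 2 + 9) / 9"
    and "B \<equiv> 4 * \<epsilon> / 9 * (3 * z + \<epsilon> ^ 2 - 3)"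
  defines "v \<equiv> - (A * x + B) * x" and "w \<equiv> z - 1 / 6 * (3 * x - j * (4 * \<epsilon>)) * x"
  defines "E \<equiv> w + (\<epsilon> ^ 2 - 3) / 3"
  defines "G \<equiv> (j - 4 * \<epsilon> / 3 * u) * E - v * u ^ 2"
    and "x' \<equiv> y - \<epsilon> / 3 * x" and "y' \<equiv> - x * z + x - \<epsilon> * y" and "z' \<equiv> x * y"
  shows "G = x' - j / 2 * x ^ 2"
    and "- 1 / x ^ 2 * x' + 0 * y' + 0 * z' = - (j / 2) - u ^ 2 * G"
    and "(j * (2 / 3 * \<epsilon>) - x) * x' + 0 * y' + 1 * z' = j * (2 / 3 * \<epsilon>) * G"
    and "- (2 * x * A - \<epsilon> / 3 * x ^ 2 + B) * x' + - (x ^ 2) * y' + (j * x ^ 2 - 4 * \<epsilon> / 3 * x) * z'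
      = j * (4 / 3 * \<epsilon>) * E * (E + 8 / 9 * \<epsilon> ^ 2) - 16 / 9 * \<epsilon> ^ 2 * u * E ^ 2
         + v * (- (2 / 3 * \<epsilon>) + j * 2 * u * (E + 4 / 9 * \<epsilon> ^ 2) - 4 * \<epsilon> * u ^ 2 * E)
         - 2 * u ^ 3 * v ^ 2"
proof -
  have ux: "u * x = 1" using x by (simp add: u_def)
  \<comment> \<open>On the right-hand sides \<open>u\<close> occurs essentially in the products \<open>v * u\<close>,
    \<open>v * u ^ 2\<close> and \<open>\<epsilon> * u * E\<close>, which can be rewritten so that all remaining
    \<open>u\<close> cancel. What is left are polynomial identities modulo \<open>j ^ 2 = - 1\<close>.\<close>
  have vu: "v * u ^ 2 = - (A + B * u)" 
    using x by (simp add: v_def u_def field_simps power2_eq_square)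
  have BE: "B = 4 * \<epsilon> / 3 * E + 4 * \<epsilon> / 3 * x * (x / 2 - j * (2 / 3 * \<epsilon>))"
    by (simp add: B_def E_def w_def field_simps power2_eq_square)
  have Bu: "B * u = 4 * \<epsilon> / 3 * u * E + 4 * \<epsilon> / 3 * (x / 2 - j * (2 / 3 * \<epsilon>))"
    unfolding BE using ux by algebra
  have AE: "A = x' - j * E - j / 2 * x ^ 2 - 2 / 3 * \<epsilon> * x + 8 / 9 * j * \<epsilon> ^ 2" 
    using j unfolding A_def x'_def E_def w_def by algebra
  show G: "G = x' - j / 2 * x ^ 2"
    unfolding G_def vu Bu AE by (simp add: algebra_simps power2_eq_square)
  show "- 1 / x ^ 2 * x' + 0 * y' + 0 * z' = - (j / 2) - u ^ 2 * G"
    unfolding G u_def using x by (simp add: field_simps)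
  show "(j * (2 / 3 * \<epsilon>) - x) * x' + 0 * y' + 1 * z' = j * (2 / 3 * \<epsilon>) * G"
    unfolding G using j unfolding z'_def x'_def by algebra
  define K where "K = 4 * \<epsilon> / 3 * (x / 2 - j * (2 / 3 * \<epsilon>))"
  have B: "B = 4 * \<epsilon> / 3 * E + K * x" and Bu: "4 * \<epsilon> / 3 * (u * E) = B * u - K"
    using BE Bu by (simp_all add: K_def algebra_simps power2_eq_square)
  \<comment> \<open>The terms in \<open>B * u\<close> that survive the substitution combine to
    \<open>8 / 3 * \<epsilon> * E - 2 * B = - 2 * K * x\<close> times \<open>B * u\<close>, where the factor
    \<open>x\<close> cancels \<open>u\<close>.\<close>
  have BuE: "(B * u) * (8 / 3 * \<epsilon> * E) = 2 * (B * u) * B - 2 * B * K"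
    using B ux by algebra
  have Bux: "B * u * x = B"
    using ux by algebra
  have v: "v = - (A * x + B) * x"
    by (simp add: v_def)
  have vu1: "v * u = - (A * x + B)"
    using x by (simp add: v_def u_def)
  have "j * (4 / 3 * \<epsilon>) * E * (E + 8 / 9 * \<epsilon> ^ 2) - 16 / 9 * \<epsilon> ^ 2 * u * E ^ 2
      + v * (- (2 / 3 * \<epsilon>) + j * 2 * u * (E + 4 / 9 * \<epsilon> ^ 2) - 4 * \<epsilon> * u ^ 2 * E)
      - 2 * u ^ 3 * v ^ 2
    = j * (4 / 3 * \<epsilon>) * E * (E + 8 / 9 * \<epsilon> ^ 2) - 4 * \<epsilon> / 3 * E * (4 * \<epsilon> / 3 * (u * E))
      - v * (2 / 3 * \<epsilon>) + j * 2 * (v * u) * (E + 4 / 9 * \<epsilon> ^ 2) - 4 * \<epsilon> * (v * u ^ 2) * E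
      - 2 * (v * u ^ 2) * (v * u)"
    by (simp add: algebra_simps power2_eq_square power3_eq_cube)
  also have "\<dots> = j * (4 / 3 * \<epsilon>) * E * (E + 8 / 9 * \<epsilon> ^ 2) + 4 * \<epsilon> / 3 * E * K
      + (A * x + B) * x * (2 / 3 * \<epsilon>) - j * 2 * (A * x + B) * (E + 4 / 9 * \<epsilon> ^ 2) + 4 * \<epsilon> * A * E
      - 2 * A * (A * x + B) - 2 * B * A - 2 * B * K"
    unfolding Bu vu vu1 using BuE Bux v by algebra
  also have "\<dots> = - (2 * x * A - \<epsilon> / 3 * x ^ 2 + B) * x' + - (x ^ 2) * y' + (j * x ^ 2 - 4 * \<epsilon> / 3 * x) * z'"
    unfolding A_def K_def B_def E_def w_def x'_def y'_def z'_def using j by algebra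
  finally show "- (2 * x * A - \<epsilon> / 3 * x ^ 2 + B) * x' + - (x ^ 2) * y' + (j * x ^ 2 - 4 * \<epsilon> / 3 * x) * z'
      = j * (4 / 3 * \<epsilon>) * E * (E + 8 / 9 * \<epsilon> ^ 2) - 16 / 9 * \<epsilon> ^ 2 * u * E ^ 2
         + v * (- (2 / 3 * \<epsilon>) + j * 2 * u * (E + 4 / 9 * \<epsilon> ^ 2) - 4 * \<epsilon> * u ^ 2 * E)
         - 2 * u ^ 3 * v ^ 2" ..
qed

lemma transport_final_chart:
  assumes s: "s ^ 2 = 1" and p: "p $ 1 \<noteq> 0"
  shows "transport (final_chart \<epsilon> s) (system_field \<epsilon>) p = chart_field \<epsilon> s (final_chart \<epsilon> s p)"
proof -
  have j: "(s * \<i>) ^ 2 = - 1" using s by (simp add: power_mult_distrib)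
  note ids = chart_velocity_identities(2-4)[OF p j, where y = "p $ 2" and \<epsilon> = \<epsilon> and z = "p $ 3"]
  show ?thesis
    unfolding transport_3[OF final_chart_gradients[OF p]] chart_field_def final_chart_def
      system_field_def Let_def vector_3 vec_eq_3
    by (intro conjI ids)
qed

section \<open>The volume form\<close>

text \<open>Expanding along the first row \<open>(- 1 / x ^ 2, 0, 0)\<close>, the Jacobian determinant is
\<open>(- 1 / x ^ 2) * (- (x ^ 2)) * 1 = 1\<close>.\<close>

lemma wedge3_final_chart:
  assumes p: "p $ 1 \<noteq> 0"
  shows "wedge3 (diff_form (\<lambda>q. final_chart \<epsilon> s q $ 1) p)
      (diff_form (\<lambda>q. final_chart \<epsilon> s q $ 2) p) (diff_form (\<lambda>q. final_chart \<epsilon> s q $ 3) p)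
    = wedge3 (diff_form (\<lambda>q. q $ 1) p) (diff_form (\<lambda>q. q $ 2) p) (diff_form (\<lambda>q. q $ 3) p)"
proof -
  have d: "diff_form f p = (\<lambda>h. \<Sum>k\<in>UNIV. g $ k * h $ k)" if "has_gradient f g p" for f g
    using frechet_derivative_at[OF that[unfolded has_gradient_def]] by (simp add: diff_form_def)
  have c: "diff_form (\<lambda>q. q $ k) p = (\<lambda>h. h $ k)" for k
    by (simp add: diff_form_def bounded_linear_imp_has_derivative[OF bounded_linear_vec_nth]
        flip: frechet_derivative_at)
  show ?thesis
    unfolding c d[OF final_chart_gradients(1)[OF p]] d[OF final_chart_gradients(2)[OF p]]
      d[OF final_chart_gradients(3)[OF p]] wedge3_def det_3 sum_3 vector_3 fun_eq_iff
    using p by (simp add: field_simps power2_eq_square)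
qed

section \<open>Accessible singular points and their resolution\<close>

text \<open>Composing the coordinate changes of the four blow-ups gives the final chart up to the sign of the
second coordinate, which is the sign that makes the Jacobian determinant \<open>1\<close> instead of
\<open>-1\<close>.\<close>

lemma resolution_chart_eq:
  assumes s: "s = 1 \<or> s = - 1" and p: "p $ 1 \<noteq> 0"
  shows "resolution_chart \<epsilon> s p $ 1 = final_chart \<epsilon> s p $ 1"
    and "resolution_chart \<epsilon> s p $ 2 = - final_chart \<epsilon> s p $ 2"
    and "resolution_chart \<epsilon> s p $ 3 = final_chart \<epsilon> s p $ 3"
  using s p
  by (auto simp: resolution_chart_def final_chart_def boundary_chart_def local_coords_def
      blowup_point_def blowup_curve_def Let_def field_simps power2_eq_square)

text \<open>In the coordinates \<open>X\<close>, \<open>Y\<close>, \<open>Z\<close> the system is \<open>X' = a\<^sub>1\<close>,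
\<open>Y' = a\<^sub>2 / X\<close>, \<open>Z' = a\<^sub>3 / X\<close> with polynomials \<open>a\<^sub>i\<close>. On
\<open>X = 0\<close> the last two are \<open>- Z - 2 * Y ^ 2\<close> and \<open>Y * (1 - 2 * Z)\<close>, which vanish
for \<open>Z = 1 / 2\<close>, \<open>Y ^ 2 = - 1 / 4\<close>.\<close>

lemma accessible_sing_point:
  assumes s: "s ^ 2 = 1"
  shows "accessible_singular_point (system_field \<epsilon>) (sing_point s)"
proof -
  define a :: "c3 \<Rightarrow> c3" where "a = (\<lambda>Q. let X = Q $ 1; Y = Q $ 2; Z = Q $ 3 in
    vector [\<epsilon> / 3 * X - Y, X ^ 2 - Z - 2 * Y ^ 2 - \<epsilon> / 3 * X * Y,
      Y * (1 - 2 * Z) + 2 / 3 * \<epsilon> * X * Z])"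
  have "rational_on3 UNIV a"
    unfolding rational_on3_iff forall_3 a_def Let_def vector_3
    by (intro conjI polynomial3_imp_rational_fun3 polynomial3_intros)
  then have "holomorphic3 a UNIV"
    by (rule rational_on3_imp_holomorphic3) simp
  moreover have "transport boundary_chart (system_field \<epsilon>) p = (let Q = boundary_chart p in
      vector [a Q $ 1, a Q $ 2 / Q $ 1, a Q $ 3 / Q $ 1])" if p: "p $ 1 \<noteq> 0" for p
  proof -
    define x y z where "x = p $ 1" and "y = p $ 2" and "z = p $ 3"
    have nth: "((\<lambda>q::c3. q $ k) has_derivative (\<lambda>h. h $ k)) (at p)" for k
      by (rule bounded_linear_imp_has_derivative[OF bounded_linear_vec_nth])
    note d = has_derivative_eq_rhs[OF nth]
    have "has_gradient (\<lambda>q. boundary_chart q $ 1) (vector [- 1 / x ^ 2, 0, 0]) p"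
      and "has_gradient (\<lambda>q. boundary_chart q $ 2) (vector [- 2 * y / x ^ 3, 1 / x ^ 2, 0]) p"
      and "has_gradient (\<lambda>q. boundary_chart q $ 3) (vector [- 2 * z / x ^ 3, 0, 1 / x ^ 2]) p"
      unfolding has_gradient_def boundary_chart_def Let_def vector_3 sum_3
      using p by (auto intro!: derivative_eq_intros d
          simp: fun_eq_iff x_def y_def z_def field_simps power2_eq_square power3_eq_cube)
    from transport_3[OF this] show ?thesis
      using p by (simp only:) (simp add: vec_eq_3 a_def boundary_chart_def system_field_def x_def y_def z_def
          Let_def field_simps power2_eq_square power3_eq_cube)
  qed
  moreover have "a (sing_point s) $ 2 = 0" "a (sing_point s) $ 3 = 0" "sing_point s $ 1 = 0"
    using s by (simp_all add: a_def sing_point_def Let_def power_mult_distrib power_divide)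
  ultimately show ?thesis
    unfolding accessible_singular_point_def by blast
qed

section \<open>Separatedness\<close>

text \<open>Clearing the denominator of the first coordinate describes the graph by polynomial equations in
both variables; the equation \<open>fst z $ 1 * snd z $ 1 = 1\<close> itself keeps the first coordinate
of \<open>fst z\<close> away from zero, so no open condition remains.\<close>

lemma closed_graph_final_chart: "closed ((\<lambda>p. (p, final_chart \<epsilon> s p)) ` {p. p $ 1 \<noteq> 0})"
proof -
  have "(\<lambda>p. (p, final_chart \<epsilon> s p)) ` {p. p $ 1 \<noteq> 0} =
    {z. fst z $ 1 * snd z $ 1 = 1 \<and>
      snd z $ 2 = - ((fst z $ 2 - \<epsilon> / 3 * fst z $ 1 - s * \<i> * fst z $ 3 + s * \<i> * (5 * \<epsilon> ^ 2 + 9) / 9) * fst z $ 1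
           + 4 * \<epsilon> / 9 * (3 * fst z $ 3 + \<epsilon> ^ 2 - 3)) * fst z $ 1 \<and>
      snd z $ 3 = fst z $ 3 - 1 / 6 * (3 * fst z $ 1 - s * \<i> * (4 * \<epsilon>)) * fst z $ 1}"
    (is "?G = ?E")
  proof
    show "?G \<subseteq> ?E"
      by (auto simp: final_chart_def Let_def)
    show "?E \<subseteq> ?G"
    proof
      fix z assume z: "z \<in> ?E"
      then have "fst z $ 1 \<noteq> 0" by auto
      moreover from this z have "z = (fst z, final_chart \<epsilon> s (fst z))"
        by (simp add: prod_eq_iff vec_eq_3 final_chart_def Let_def) (simp add: field_simps)
      ultimately show "z \<in> ?G" by blast
    qed
  qed
  also have "closed \<dots>"
    by (intro closed_Collect_conj closed_Collect_eq continuous_intros)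
  finally show ?thesis .
qed

text \<open>No sequence in the original space converges both to a point added by one resolution and to a point
added by the other. With \<open>u = 1 / x\<close> the common first coordinate, the third coordinates differ by
\<open>s * \<i> * (4 / 3 * \<epsilon>) / u\<close>, which separates nothing when \<open>\<epsilon> = 0\<close>, but the second
coordinates differ by \<open>u ^ (- 4)\<close> times a polynomial with constant term \<open>s * \<i>\<close>.
Multiplying by \<open>u ^ 4\<close> gives an equation that fails on \<open>u = 0\<close>, so the graph is again
cut out by polynomial equations alone.\<close>

lemma closed_graph_final_charts:
  assumes s: "s ^ 2 = 1"
  shows "closed ((\<lambda>p. (final_chart \<epsilon> s p, final_chart \<epsilon> (- s) p)) ` {p. p $ 1 \<noteq> 0})"
proof -
  let ?P = "\<lambda>a b :: c3. b $ 1 = a $ 1 \<and> a $ 1 * (a $ 3 - b $ 3) = s * \<i> * (4 / 3 * \<epsilon>) \<and>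
      a $ 1 ^ 4 * (a $ 2 - b $ 2) =
        s * \<i> * (2 * a $ 1 ^ 2 * a $ 3 + 1 - s * \<i> * (4 / 3 * \<epsilon>) * a $ 1 - 2 / 9 * (5 * \<epsilon> ^ 2 + 9) * a $ 1 ^ 2)"
  have fwd: "?P (final_chart \<epsilon> s p) (final_chart \<epsilon> (- s) p)" if "p $ 1 \<noteq> 0" for p
    using that by (simp add: final_chart_def Let_def field_simps power2_eq_square power4_eq_xxxx)
  have bwd: "\<exists>p. p $ 1 \<noteq> 0 \<and> a = final_chart \<epsilon> s p \<and> b = final_chart \<epsilon> (- s) p" if ab: "?P a b" for a b
  proof (intro exI conjI)
    have "s \<noteq> 0" using s by auto
    then show p1: "final_chart_inverse \<epsilon> s a $ 1 \<noteq> 0"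
      using ab by (auto simp: final_chart_inverse_def Let_def)
    have a1: "a $ 1 \<noteq> 0" using ab \<open>s \<noteq> 0\<close> by auto
    show a: "a = final_chart \<epsilon> s (final_chart_inverse \<epsilon> s a)"
      using final_chart_inverse_right[OF a1] by simp
    define b' where "b' = final_chart \<epsilon> (- s) (final_chart_inverse \<epsilon> s a)"
    have "?P a b'"
      using fwd[OF p1] unfolding b'_def a[symmetric] .
    then have "b $ 1 = b' $ 1" "a $ 1 * (a $ 3 - b $ 3) = a $ 1 * (a $ 3 - b' $ 3)"
      "a $ 1 ^ 4 * (a $ 2 - b $ 2) = a $ 1 ^ 4 * (a $ 2 - b' $ 2)"
      using ab by presburger+
    then show "b = final_chart \<epsilon> (- s) (final_chart_inverse \<epsilon> s a)"
      using a1 by (simp add: vec_eq_3 b'_def)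
  qed
  have "(\<lambda>p. (final_chart \<epsilon> s p, final_chart \<epsilon> (- s) p)) ` {p. p $ 1 \<noteq> 0} =
      {z. ?P (fst z) (snd z)}"
    using fwd bwd by (fastforce simp: image_iff)
  also have "closed \<dots>"
    by (intro closed_Collect_conj closed_Collect_eq continuous_intros)
  finally show ?thesis .
qed

lemma closed_swap_image:
  fixes f g :: "c3 \<Rightarrow> c3"
  assumes "closed ((\<lambda>p. (f p, g p)) ` S)"
  shows "closed ((\<lambda>p. (g p, f p)) ` S)"
proof -
  have "(\<lambda>p. (g p, f p)) ` S = prod.swap -` ((\<lambda>p. (f p, g p)) ` S)"
    by (auto simp: image_iff)
  then show ?thesis
    using assms by (auto intro!: closed_vimage continuous_intros)
qed

section \<open>The phase space\<close>

definition U_inverse :: "complex \<Rightarrow> nat \<Rightarrow> c3 \<Rightarrow> c3" where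
  "U_inverse \<epsilon> j = (if j = 0 then (\<lambda>a. a) else final_chart_inverse \<epsilon> (if j = 1 then 1 else - 1))"

text \<open>A transition between the two charts at infinity is covered by the case \<open>s = 1\<close> of the graph
of the pair for \<open>s\<close> and \<open>- s\<close>; the opposite directions follow by exchanging factors.\<close>

lemma affine_gluing_U_coords: "affine_gluing {0, 1, 2} overlap (U_coords \<epsilon>) (U_inverse \<epsilon>)"
proof
  note defs = overlap_def U_coords_def U_inverse_def U1_coords_eq U2_coords_eq
  show "countable {0, 1, 2 :: nat}" by simp
  show "U_inverse \<epsilon> i (U_coords \<epsilon> i p) = p" if "i \<in> {0, 1, 2}" "p \<in> overlap i" for i p
    using that by (auto simp: defs final_chart_inverse_left)
  show "holomorphic3 (U_coords \<epsilon> i) (overlap i)" if "i \<in> {0, 1, 2}" for i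
    using that by (auto simp: defs holomorphic3_ident open_nonzero_coord
        intro: rational_on3_imp_holomorphic3[OF rational_final_chart])
  show "holomorphic3 (U_inverse \<epsilon> i) (U_coords \<epsilon> i ` overlap i)" if "i \<in> {0, 1, 2}" for i
    using that by (auto simp: defs holomorphic3_ident open_nonzero_coord final_chart_image
        intro: rational_on3_imp_holomorphic3[OF rational_final_chart_inverse])
  show "closed ((\<lambda>p. (U_coords \<epsilon> i p, U_coords \<epsilon> j p)) ` (overlap i \<inter> overlap j))"
    if "i \<in> {0, 1, 2}" "j \<in> {0, 1, 2}" "i \<noteq> j" for i j
  proof -
    note g = closed_graph_final_chart[of \<epsilon> 1] closed_graph_final_chart[of \<epsilon> "- 1"]
      closed_graph_final_charts[of 1 \<epsilon>, simplified]
    show ?thesis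
      using that g g[THEN closed_swap_image] by (auto simp: defs)
  qed
qed

lemma final_chart_equal_up_to_signs:
  assumes "s = 1 \<or> s = - 1"
  shows "equal_up_to_signs_on {p. p $ 1 \<noteq> 0} (final_chart \<epsilon> s) (resolution_chart \<epsilon> s)"
  unfolding equal_up_to_signs_on_def forall_3
  using resolution_chart_eq[OF assms]
  by (intro exI[of _ "\<lambda>k. if k = 2 then - 1 else 1"]) simp

lemma birational_final_chart:
  "birational_between {p. p $ 1 \<noteq> 0} {a. a $ 1 \<noteq> 0} (final_chart \<epsilon> s)"
proof -
  let ?S = "{p :: c3. p $ 1 \<noteq> 0}"
  have inj: "inj_on (final_chart \<epsilon> s) ?S"
    by (rule inj_on_inverseI[where g = "final_chart_inverse \<epsilon> s"]) (simp add: final_chart_inverse_left)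
  have bij: "bij_betw (final_chart \<epsilon> s) ?S ?S"
    using inj by (simp add: bij_betw_def final_chart_image)
  have inv: "inv_into ?S (final_chart \<epsilon> s) a = final_chart_inverse \<epsilon> s a" if "a \<in> ?S" for a
    by (rule inv_into_f_eq[OF inj]) (use that in \<open>auto simp: final_chart_inverse_right\<close>,
      simp add: final_chart_inverse_def Let_def)
  have "(vector [1, 0, 0] :: c3) \<in> ?S" by simp
  then have "principal_open3 ?S"
    unfolding principal_open3_def using polynomial3_coord[of 1] by blast
  moreover have "rational_on3 ?S (inv_into ?S (final_chart \<epsilon> s))"
    using rational_final_chart_inverse[of \<epsilon> s] inv unfolding rational_on3_def by simp
  ultimately show ?thesis
    unfolding birational_between_def using bij rational_final_chart by blast
qed

lemma polynomial_in_final_chart: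
  assumes "s ^ 2 = 1"
  shows "polynomial_in_chart (system_field \<epsilon>) {p. p $ 1 \<noteq> 0} (final_chart \<epsilon> s)"
  unfolding polynomial_in_chart_def
  using polynomial3_chart_field transport_final_chart[OF assms] by blast

lemma polynomial_in_original_chart: "polynomial_in_chart (system_field \<epsilon>) S (\<lambda>p. p)"
proof -
  have "\<forall>k. polynomial3 (\<lambda>a. system_field \<epsilon> a $ k)"
    unfolding forall_3 system_field_def Let_def vector_3 by (intro conjI polynomial3_intros)
  then show ?thesis
    unfolding polynomial_in_chart_def transport_def by (auto simp: frechet_derivative_ident)
qed

theorem theorem3p1:
  fixes \<epsilon> :: complex
  shows "is_phase_space \<epsilon> (U_coords \<epsilon>) \<and>
    (\<forall>i\<in>{1, 2}. birational_between (overlap i) {a. a $ 1 \<noteq> 0} (U_coords \<epsilon> i)) \<and>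
    (\<forall>i\<in>{1, 2}. \<forall>p\<in>overlap i.
       wedge3 (diff_form (\<lambda>q. U_coords \<epsilon> i q $ 1) p)
              (diff_form (\<lambda>q. U_coords \<epsilon> i q $ 2) p)
              (diff_form (\<lambda>q. U_coords \<epsilon> i q $ 3) p)
       = wedge3 (diff_form (\<lambda>q. q $ 1) p) (diff_form (\<lambda>q. q $ 2) p) (diff_form (\<lambda>q. q $ 3) p))"
proof -
  have D: "overlap 0 = UNIV" "overlap 1 = {p. p $ 1 \<noteq> 0}" "overlap 2 = {p. p $ 1 \<noteq> 0}"
    by (simp_all add: overlap_def)
  have U: "U_coords \<epsilon> 0 = (\<lambda>p. p)" "U_coords \<epsilon> 1 = final_chart \<epsilon> 1"
      "U_coords \<epsilon> 2 = final_chart \<epsilon> (- 1)"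
    by (simp_all add: U_coords_def U1_coords_eq U2_coords_eq)
  interpret affine_gluing "{0, 1, 2}" overlap "U_coords \<epsilon>" "U_inverse \<epsilon>"
    by (rule affine_gluing_U_coords)
  have "is_phase_space \<epsilon> (U_coords \<epsilon>)"
    unfolding is_phase_space_def ball_simps
    using accessible_sing_point[of 1] accessible_sing_point[of "- 1"] equiv_glue_rel
      complex_threefold_glue_space polynomial_in_original_chart
      polynomial_in_final_chart[of 1] polynomial_in_final_chart[of "- 1"]
      final_chart_equal_up_to_signs[of 1] final_chart_equal_up_to_signs[of "- 1"]
    by (simp add: D U del: One_nat_def)
  then show ?thesis
    using birational_final_chart wedge3_final_chart by (simp add: D U del: One_nat_def)
qed

end
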